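(* Let $z^*=(x^*,y^* )$ be an optimal solution (global minimizer) of the problem $\min\{f(z):z\in F\}$ and let $A:=\mathscr{A}\times_3y^*\in\mathbb{R}^{l\times m}$. If $\nabla_{\gamma_{x^*}}f(z^* )=0$ and $$L>\max\left\{\lambda_{\max}(A^\top A),\ \max_{i\in I_2\setminus\Gamma_2^*}\frac{|\nabla_if(z^* )|}{M_t(|y^*|)}\right\},$$ then $z^*$ is an $L$-like stationary point of this problem, and $\bar{\mathbf P}_F(z^*-\nabla f(z^* )/L)$ is a singleton; thus $\bar{\mathbf P}_F(z^*-\nabla f(z^* )/L)=\{z^*\}$.
   Context: $l,m,n,s,t$ are positive integers with $s<m$, $t<n$; $\mathscr{A}=(a_{ijk})\in\mathbb{R}^{l\times m\times n}$ and $b\in\mathbb{R}^l$ are given. For $x\in\mathbb{R}^m$, $y\in\mathbb{R}^n$: $(\mathscr{A}\times_3y)_{ij}=\sum_ka_{ijk}y_k$, $(\mathscr{A}xy)_i=\sum_{j,k}a_{ijk}x_jy_k$, and $f(z)=f(x,y)=\frac12\|\mathscr{A}xy-b\|^2$ for $z=(x,y)\in\mathbb{R}^{m+n}$; $\nabla_if$ is the $i$-th component of $\nabla f$. $I=\{1,\dots,m+n\}$, $I_1=\{1,\dots,m\}$, $I_2=\{m+1,\dots,m+n\}$; coordinates of $y$ are indexed by $I_2$. $\Gamma_2^*=\{i\in I_2:z_i^*\ne0\}$. $\lambda_{\max}(S)$ for symmetric $S$ is the largest absolute value of an eigenvalue of $S$. $|y|$ is the entrywise absolute value and $M_i(v)$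 is the value of the $i$-th largest entry of $v$. If $M_t(|y^*|)=0$, a quotient $0/0$ is read as $0$. $\|\cdot\|_0$ counts nonzero entries. For $x\ne0$, $\gamma_x$ is the index of the first nonzero entry of $x$. $F_1=\{x\in\mathbb{R}^m:\|x\|_0\le s,\ e_{\gamma_x}^\top x=1\}$ (nonzero vectors with at most $s$ nonzero entries and first nonzero entry equal to $1$), $F_2=\{y\in\mathbb{R}^n:\|y\|_0\le t\}$, $F=F_1\times F_2$. Like-projection: for $z=(x,y)\in\mathbb{R}^{m+n}$ define $\psi_z$ by: if $x=0$, $\psi_z(u)=u$; if $x\ne0$, $(\psi_z(u))_i=x_{\gamma_u^z}u_i$ for $i\in I_1$ and $(\psi_z(u))_i=u_i/x_{\gamma_u^z}$ for $i\in I_2$, where $\gamma_u^z:=\min\{i\in I_1:u_i\ne0,\ z_i\ne0\}$. The like-projection of $z$ onto $F$ is the set $\bar{\mathbf P}_F(z)=\arg\min_{u\in F}\|\psi_z(u)-z\|^2$, the minimum being over those $u\in F$ for which $\psi_z(u)$ is defined (for $x\ne0$, those for which the index set defining $\gamma_u^z$ is nonempty). For $L>0$, $z^*=(x^*,y^* )\in F$ is an $L$-like stationary point if $z^*\in\bar{\mathbf P}_F(z^*-\nabla f(z^* )/L)$ and $\nabla_{\gamma_{x^*}}f(z^* )=0$. *)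

theory Defs
  imports "HOL-Analysis.Analysis" "HOL-Library.Multiset"
begin

text \<open>
  The spaces \<open>R^l\<close>, \<open>R^m\<close>, \<open>R^n\<close> are \<open>real^'l\<close>, \<open>real^'m\<close>, \<open>real^'n\<close>. A pair \<open>z = (x, y)\<close> is an
  element of the Euclidean product space \<open>(real^'m) \<times> (real^'n)\<close>, so the index sets \<open>I\<^sub>1\<close> and
  \<open>I\<^sub>2\<close> are the types \<open>'m\<close> and \<open>'n\<close>. The type \<open>'m\<close> carries a linear order because the first
  nonzero entry of \<open>x\<close> is needed.
\<close>

type_synonym ('m, 'n) zvec = "(real^'m) \<times> (real^'n)"

definition contract3 :: "real^'n^'m^'l \<Rightarrow> real^'n \<Rightarrow> real^'m^'l" where
  "contract3 T y = (\<chi> i j. \<Sum>k\<in>UNIV. T $ i $ j $ k * y $ k)"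

definition tensor_apply :: "real^'n^'m^'l \<Rightarrow> real^'m \<Rightarrow> real^'n \<Rightarrow> real^'l" where
  "tensor_apply T x y = (\<chi> i. \<Sum>j\<in>UNIV. \<Sum>k\<in>UNIV. T $ i $ j $ k * x $ j * y $ k)"

definition objective :: "real^'n^'m^'l \<Rightarrow> real^'l \<Rightarrow> ('m::finite, 'n::finite) zvec \<Rightarrow> real" where
  "objective T b z = 1 / 2 * (norm (tensor_apply T (fst z) (snd z) - b))\<^sup>2"

definition gradient :: "('a::real_inner \<Rightarrow> real) \<Rightarrow> 'a \<Rightarrow> 'a" where
  "gradient f z = (THE d. GDERIV f z :> d)"

definition supp :: "real^'k \<Rightarrow> 'k set" where
  "supp x = {i. x $ i \<noteq> 0}"

definition norm0 :: "real^'k \<Rightarrow> nat" where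
  "norm0 x = card (supp x)"

definition first_nonzero :: "real^'m::{finite,linorder} \<Rightarrow> 'm" where
  "first_nonzero x = Min (supp x)"

definition F1 :: "nat \<Rightarrow> (real^'m::{finite,linorder}) set" where
  "F1 s = {x. x \<noteq> 0 \<and> norm0 x \<le> s \<and> x $ first_nonzero x = 1}"

definition F2 :: "nat \<Rightarrow> (real^'n) set" where
  "F2 t = {y. norm0 y \<le> t}"

definition feasible :: "nat \<Rightarrow> nat \<Rightarrow> ('m::{finite,linorder}, 'n::finite) zvec set" where
  "feasible s t = F1 s \<times> F2 t"

definition eigenvalues :: "real^'k^'k \<Rightarrow> real set" where
  "eigenvalues S = {e. \<exists>v. v \<noteq> 0 \<and> S *v v = e *\<^sub>R v}"

text \<open>Only meant for symmetric \<open>S\<close>, whose eigenvalues are all real.\<close>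

definition lambda_max :: "real^'k^'k \<Rightarrow> real" where
  "lambda_max S = Max (abs ` eigenvalues S)"

definition abs_vec :: "real^'k \<Rightarrow> real^'k" where
  "abs_vec v = (\<chi> i. \<bar>v $ i\<bar>)"

text \<open>The \<open>i\<close>-th largest entry, \<open>i\<close> counted from 1, equal entries counted with multiplicity.\<close>

definition kth_largest :: "nat \<Rightarrow> real^'k \<Rightarrow> real" where
  "kth_largest i v =
     rev (sorted_list_of_multiset (image_mset (\<lambda>k. v $ k) (mset_set UNIV))) ! (i - 1)"

definition common_supp ::
  "('m::finite, 'n::finite) zvec \<Rightarrow> ('m, 'n) zvec \<Rightarrow> 'm set" where
  "common_supp z u = {i. fst u $ i \<noteq> 0 \<and> fst z $ i \<noteq> 0}"

definition psi_defined ::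
  "('m::finite, 'n::finite) zvec \<Rightarrow> ('m, 'n) zvec \<Rightarrow> bool" where
  "psi_defined z u \<longleftrightarrow> fst z = 0 \<or> common_supp z u \<noteq> {}"

text \<open>The value of \<open>psi z u\<close> is irrelevant unless \<open>psi_defined z u\<close>.\<close>

definition psi ::
  "('m::{finite,linorder}, 'n::finite) zvec \<Rightarrow> ('m, 'n) zvec \<Rightarrow> ('m, 'n) zvec" where
  "psi z u =
     (if fst z = 0 then u
      else let c = fst z $ Min (common_supp z u)
           in ((\<chi> i. c * fst u $ i), (\<chi> i. snd u $ i / c)))"

definition like_projection ::
  "nat \<Rightarrow> nat \<Rightarrow> ('m::{finite,linorder}, 'n::finite) zvec \<Rightarrow> ('m, 'n) zvec set" where
  "like_projection s t z =
     {u. is_arg_min (\<lambda>u. (norm (psi z u - z))\<^sup>2) (\<lambda>u. u \<in> feasible s t \<and> psi_defined z u) u}"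

definition like_stationary ::
  "real^'n^'m::{finite,linorder}^'l \<Rightarrow> real^'l \<Rightarrow> nat \<Rightarrow> nat \<Rightarrow> real \<Rightarrow>
     ('m, 'n) zvec \<Rightarrow> bool" where
  "like_stationary T b s t L z \<longleftrightarrow>
     L > 0 \<and> z \<in> feasible s t \<and>
     z \<in> like_projection s t (z - gradient (objective T b) z /\<^sub>R L) \<and>
     fst (gradient (objective T b) z) $ first_nonzero (fst z) = 0"

end

theory Submission
  imports Defs
begin

text \<open>
  Let \<open>g\<close> be the gradient at \<open>(x, y)\<close> and \<open>w = (p, q) = (x, y) - g / L\<close>. Since \<open>g\<close> vanishes at the
  pivot index of \<open>x\<close>, \<open>p\<close> is nonzero and \<open>psi w u\<close> has the form \<open>(c u\<^sub>1, u\<^sub>2 / c)\<close> with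
  \<open>c \<noteq> 0\<close>. For feasible \<open>u\<close> it therefore consists of a nonzero \<open>s\<close>-sparse vector and a
  \<open>t\<close>-sparse vector, and it equals \<open>(x, y)\<close> only if \<open>u = (x, y)\<close>, because both \<open>u\<^sub>1\<close> and \<open>x\<close>
  are normalized at their first nonzero entry. As the squared distance to \<open>w\<close> splits over the two
  blocks, it suffices that each block of \<open>(x, y)\<close> is the strictly nearest sparse vector.

  For the first block (\<open>gradient_step_fst_unique\<close>), the objective is unchanged when \<open>x\<close> is
  multiplied and \<open>y\<close> divided by the same scalar, so \<open>x\<close> is optimal for fixed \<open>y\<close> among all nonzero
  \<open>s\<close>-sparse vectors and not only among the normalized ones (\<open>optimal_fst_unnormalized\<close>). The
  objective is a quadratic in \<open>x\<close> whose curvature is at most the largest eigenvalue of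
  \<open>A\<^sup>T A\<close> (\<open>norm_matrix_vector_le_lambda_max\<close>), hence less than \<open>L\<close>. A competitor
  \<open>v \<noteq> x\<close> at most as far from \<open>p\<close> as \<open>x\<close> would then have a smaller objective value.

  For the second block (\<open>gradient_step_snd_unique\<close>), perturbing single coordinates shows that the
  gradient vanishes on the support of \<open>y\<close>, and everywhere if fewer than \<open>t\<close> entries are
  nonzero. In the latter case \<open>q = y\<close>. Otherwise the bound on \<open>L\<close> says that the entries of \<open>q\<close>
  off the support are smaller than the least nonzero entry of \<open>y\<close> in absolute value, so that \<open>y\<close>
  keeps exactly the \<open>t\<close> entries of \<open>q\<close> that are largest in absolute value.
\<close>

section \<open>The largest eigenvalue of a symmetric matrix bounds its quadratic form\<close>

text \<open>The first-order condition along a line, in a form that applies both to the Rayleigh quotient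
  and to coordinate perturbations of the objective.\<close>

lemma quadratic_nonneg_imp_linear_coeff_zero:
  fixes a c :: real
  assumes "\<And>\<tau>. 0 \<le> \<tau> * a + \<tau>\<^sup>2 * c"
  shows "a = 0"
proof (rule ccontr)
  assume "a \<noteq> 0"
  define k where "k = \<bar>c\<bar> + 1"
  have k: "k > 0" "c < k" unfolding k_def by auto
  have "0 \<le> (- a / k) * a + (- a / k)\<^sup>2 * c" by (rule assms)
  also have "\<dots> = a\<^sup>2 / k * (c / k - 1)"
    using k by (simp add: field_simps power2_eq_square)
  also have "\<dots> < 0"
    using k \<open>a \<noteq> 0\<close> by (intro mult_pos_neg) auto
  finally show False by simp
qed

lemma symmetric_inner_matrix_vector:
  fixes S :: "real^'k^'k"
  assumes "transpose S = S"
  shows "inner u (S *v v) = inner (S *v u) v"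
  by (metis assms dot_lmul_matrix transpose_matrix_vector)

text \<open>Eigenvectors for distinct eigenvalues are orthogonal, hence independent, so there are at most
  as many eigenvalues as dimensions.\<close>

lemma finite_eigenvalues_symmetric:
  fixes S :: "real^'k^'k"
  assumes sym: "transpose S = S"
  shows "finite (eigenvalues S)"
proof -
  have "\<forall>e. \<exists>v. e \<in> eigenvalues S \<longrightarrow> v \<noteq> 0 \<and> S *v v = e *\<^sub>R v"
    by (auto simp: eigenvalues_def)
  then obtain w where w: "\<And>e. e \<in> eigenvalues S \<Longrightarrow> w e \<noteq> 0 \<and> S *v w e = e *\<^sub>R w e"
    by metis
  have orth: "inner (w d) (w e) = 0" if "d \<in> eigenvalues S" "e \<in> eigenvalues S" "d \<noteq> e" for d e
  proof -
    have "e * inner (w d) (w e) = d * inner (w d) (w e)"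
      using symmetric_inner_matrix_vector[OF sym, of "w d" "w e"] w[OF that(1)] w[OF that(2)]
      by simp
    then show ?thesis using that(3) by simp
  qed
  have "inj_on w (eigenvalues S)"
  proof (rule inj_onI, rule ccontr)
    fix d e assume "d \<in> eigenvalues S" "e \<in> eigenvalues S" "w d = w e" "d \<noteq> e"
    then show False using orth[of d e] w[of e] by simp
  qed
  moreover have "pairwise orthogonal (w ` eigenvalues S)"
    using orth by (fastforce simp: pairwise_def orthogonal_def)
  then have "finite (w ` eigenvalues S)"
    using w by (intro independent_imp_finite pairwise_orthogonal_independent) auto
  ultimately show ?thesis by (rule finite_imageD[rotated])
qed

text \<open>The quadratic form attains its maximum \<open>\<mu>\<close> on the unit sphere at some \<open>v\<close>. The form of
  \<open>\<mu> I - S\<close> is nonnegative and vanishes at \<open>v\<close>; the vanishing of its first variation there says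
  that \<open>v\<close> is an eigenvector, so \<open>\<mu>\<close> is an eigenvalue.\<close>

lemma symmetric_quadratic_form_le_eigenvalue:
  fixes S :: "real^'k^'k"
  assumes sym: "transpose S = S"
  obtains \<mu> where "\<mu> \<in> eigenvalues S" "\<And>d. inner d (S *v d) \<le> \<mu> * (norm d)\<^sup>2"
proof -
  have "continuous_on (sphere 0 1) (\<lambda>d. inner d (S *v d))"
    by (intro continuous_intros linear_continuous_on matrix_vector_mul_bounded_linear)
  moreover have "axis undefined 1 \<in> (sphere 0 1 :: (real^'k) set)"
    by simp
  ultimately obtain v where v: "norm v = 1"
      and vmax: "\<And>d. norm d = 1 \<Longrightarrow> inner d (S *v d) \<le> inner v (S *v v)"
    using continuous_attains_sup[of "sphere (0::real^'k) 1" "\<lambda>d. inner d (S *v d)"] by force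
  define \<mu> where "\<mu> = inner v (S *v v)"
  have bound: "inner d (S *v d) \<le> \<mu> * (norm d)\<^sup>2" for d
  proof (cases "d = 0")
    case False
    have "inner (d /\<^sub>R norm d) (S *v (d /\<^sub>R norm d)) \<le> \<mu>"
      unfolding \<mu>_def by (rule vmax) (use False in simp)
    then show ?thesis
      using False
      by (simp add: matrix_vector_mult_scaleR field_simps power2_eq_square)
  qed simp
  define r where "r = \<mu> *\<^sub>R v - S *v v"
  have "2 * inner r r = 0"
  proof (rule quadratic_nonneg_imp_linear_coeff_zero)
    fix \<tau> :: real
    have n: "(norm (v + \<tau> *\<^sub>R r))\<^sup>2 = 1 + 2 * \<tau> * inner v r + \<tau>\<^sup>2 * inner r r"
      unfolding power2_norm_eq_inner using v
      by (simp add: inner_add inner_commute power2_eq_square norm_eq_1 algebra_simps)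
    have q: "inner (v + \<tau> *\<^sub>R r) (S *v (v + \<tau> *\<^sub>R r))
        = \<mu> + 2 * \<tau> * inner (S *v v) r + \<tau>\<^sup>2 * inner r (S *v r)"
      using symmetric_inner_matrix_vector[OF sym, of v r]
      by (simp add: \<mu>_def matrix_vector_right_distrib matrix_vector_mult_scaleR inner_add
          inner_commute power2_eq_square algebra_simps)
    have r: "inner r r = \<mu> * inner v r - inner (S *v v) r"
      by (metis inner_diff_left inner_scaleR_left r_def)
    show "0 \<le> \<tau> * (2 * inner r r) + \<tau>\<^sup>2 * (\<mu> * inner r r - inner r (S *v r))"
      using bound[of "v + \<tau> *\<^sub>R r"] unfolding n q by (simp add: r algebra_simps)
  qed
  then have "S *v v = \<mu> *\<^sub>R v" by (simp add: r_def)
  then have "\<mu> \<in> eigenvalues S"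
    using v by (auto simp: eigenvalues_def intro!: exI[of _ v])
  with bound show ?thesis by (rule that[rotated])
qed

lemma lambda_max_gram:
  fixes A :: "real^'m^'l"
  shows lambda_max_gram_nonneg: "0 \<le> lambda_max (transpose A ** A)"
    and norm_matrix_vector_le_lambda_max:
      "(norm (A *v d))\<^sup>2 \<le> lambda_max (transpose A ** A) * (norm d)\<^sup>2"
proof -
  let ?S = "transpose A ** A"
  have sym: "transpose ?S = ?S" by (simp add: matrix_transpose_mul)
  obtain \<mu> where mu: "\<mu> \<in> eigenvalues ?S" "\<And>d. inner d (?S *v d) \<le> \<mu> * (norm d)\<^sup>2"
    using symmetric_quadratic_form_le_eigenvalue[OF sym] by blast
  have le: "\<bar>\<mu>\<bar> \<le> lambda_max ?S"
    unfolding lambda_max_def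
    by (intro Max_ge finite_imageI finite_eigenvalues_symmetric sym imageI mu)
  then show "0 \<le> lambda_max ?S" by linarith
  have "(norm (A *v d))\<^sup>2 = inner d (?S *v d)"
    by (metis dot_lmul_matrix inner_commute matrix_vector_mul_assoc power2_norm_eq_inner
        transpose_matrix_vector)
  also have "\<dots> \<le> \<mu> * (norm d)\<^sup>2" by (rule mu)
  also have "\<dots> \<le> lambda_max ?S * (norm d)\<^sup>2" using le by (intro mult_right_mono) auto
  finally show "(norm (A *v d))\<^sup>2 \<le> lambda_max ?S * (norm d)\<^sup>2" .
qed

section \<open>Order statistics\<close>

text \<open>Counting entries above a threshold replaces reasoning about the sorted list: lower bounds on
  the \<open>k\<close>-th largest entry, and upper bounds by contraposition, become cardinality estimates.\<close>

lemma kth_largest_ge_iff: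
  fixes v :: "real^'k"
  assumes "1 \<le> k" "k \<le> CARD('k)"
  shows "c \<le> kth_largest k v \<longleftrightarrow> k \<le> card {i. c \<le> v $ i}"
proof -
  define M where "M = image_mset (\<lambda>k. v $ k) (mset_set (UNIV :: 'k set))"
  define ys where "ys = rev (sorted_list_of_multiset M)"
  have mset: "mset ys = M" by (simp add: ys_def)
  have len: "length ys = CARD('k)"
    by (metis M_def mset size_image_mset size_mset size_mset_set)
  have desc: "ys ! j \<le> ys ! i" if "i \<le> j" "j < length ys" for i j
    using that by (auto simp: ys_def intro!: sorted_rev_nth_mono)
  have "card {i. c \<le> v $ i} = size (filter_mset (\<lambda>a. c \<le> a) M)"
    by (simp add: M_def filter_mset_image_mset)
  also have "\<dots> = length (filter (\<lambda>a. c \<le> a) ys)"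
    by (metis mset mset_filter size_mset)
  also have "\<dots> = card {i. i < length ys \<and> c \<le> ys ! i}"
    by (rule length_filter_conv_card)
  finally have card: "card {i. c \<le> v $ i} = card {i. i < length ys \<and> c \<le> ys ! i}" .
  have kth: "kth_largest k v = ys ! (k - 1)"
    by (simp add: kth_largest_def ys_def M_def)
  show ?thesis
  proof
    assume "c \<le> kth_largest k v"
    then have "i < length ys \<and> c \<le> ys ! i" if "i < k" for i
      using that assms len desc[of i "k - 1"] unfolding kth by (auto elim: order_trans)
    then have "{..<k} \<subseteq> {i. i < length ys \<and> c \<le> ys ! i}" by auto
    then have "card {..<k} \<le> card {i. i < length ys \<and> c \<le> ys ! i}"
      by (intro card_mono) auto
    then show "k \<le> card {i. c \<le> v $ i}" by (simp add: card)
  next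
    assume k: "k \<le> card {i. c \<le> v $ i}"
    show "c \<le> kth_largest k v"
    proof (rule ccontr)
      assume "\<not> c \<le> kth_largest k v"
      then have "{i. i < length ys \<and> c \<le> ys ! i} \<subseteq> {..<k - 1}"
        using desc[of "k - 1"] unfolding kth by (force simp: not_le[symmetric])
      then have "card {i. i < length ys \<and> c \<le> ys ! i} \<le> card {..<k - 1}"
        by (intro card_mono) auto
      then show False using k assms by (simp add: card)
    qed
  qed
qed

lemma kth_largest_abs_vec_full_support:
  fixes y :: "real^'k"
  assumes "1 \<le> k" "card (supp y) = k"
  shows kth_largest_abs_vec_pos: "0 < kth_largest k (abs_vec y)"
    and kth_largest_abs_vec_le: "j \<in> supp y \<Longrightarrow> kth_largest k (abs_vec y) \<le> \<bar>y $ j\<bar>"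
proof -
  have k: "1 \<le> k" "k \<le> CARD('k)" using assms card_mono[of UNIV "supp y"] by auto
  have ne: "supp y \<noteq> {}" using assms by auto
  \<comment> \<open>At least \<open>k\<close> entries have absolute value \<open>c\<close> or more.\<close>
  define c where "c = Min ((\<lambda>i. \<bar>y $ i\<bar>) ` supp y)"
  have "c \<in> (\<lambda>i. \<bar>y $ i\<bar>) ` supp y" unfolding c_def using ne by (intro Min_in) auto
  then have c: "0 < c" by (auto simp: supp_def)
  have "supp y \<subseteq> {i. c \<le> abs_vec y $ i}" by (auto simp: c_def abs_vec_def)
  then have "k \<le> card {i. c \<le> abs_vec y $ i}"
    using card_mono[of "{i. c \<le> abs_vec y $ i}" "supp y"] assms(2) by simp
  then show pos: "0 < kth_largest k (abs_vec y)"
    using c kth_largest_ge_iff[OF k, of c "abs_vec y"] by simp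
  assume j: "j \<in> supp y"
  show "kth_largest k (abs_vec y) \<le> \<bar>y $ j\<bar>"
  proof (rule ccontr)
    assume "\<not> ?thesis"
    then have "{i. kth_largest k (abs_vec y) \<le> abs_vec y $ i} \<subseteq> supp y - {j}"
      using pos by (auto simp: abs_vec_def supp_def)
    then have "card {i. kth_largest k (abs_vec y) \<le> abs_vec y $ i} \<le> card (supp y - {j})"
      by (intro card_mono) auto
    then show False
      using kth_largest_ge_iff[OF k, of "kth_largest k (abs_vec y)" "abs_vec y"] j assms by simp
  qed
qed

section \<open>The objective and its gradient\<close>

lemma bounded_bilinear_tensor_apply:
  "bounded_bilinear (tensor_apply T :: real^'m \<Rightarrow> real^'n \<Rightarrow> real^'l)"
  unfolding bilinear_conv_bounded_bilinear[symmetric] bilinear_def tensor_apply_def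
  by (auto intro!: linearI simp: vec_eq_iff sum.distrib sum_distrib_left algebra_simps)

lemma tensor_apply_eq_contract3: "tensor_apply T x y = contract3 T y *v x"
  unfolding tensor_apply_def contract3_def matrix_vector_mult_def
  by (simp add: vec_eq_iff sum_distrib_right sum_distrib_left mult_ac)

text \<open>The gradient is used only through the directional derivatives that it represents; its
  existence comes from the adjoint of the derivative.\<close>

lemma inner_gradient_objective:
  fixes T :: "real^'n^'m^'l" and z h :: "('m::finite, 'n::finite) zvec"
  shows "inner (gradient (objective T b) z) h
    = inner (tensor_apply T (fst z) (snd z) - b)
        (tensor_apply T (fst h) (snd z) + tensor_apply T (fst z) (snd h))"
proof -
  interpret bounded_bilinear "tensor_apply T" by (rule bounded_bilinear_tensor_apply)
  let ?r = "tensor_apply T (fst z) (snd z) - b"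
  define D where "D = (\<lambda>h. inner ?r (tensor_apply T (fst h) (snd z) + tensor_apply T (fst z) (snd h)))"
  have obj: "objective T b = (\<lambda>z. 1 / 2 * inner (tensor_apply T (fst z) (snd z) - b)
      (tensor_apply T (fst z) (snd z) - b))"
    by (auto simp: objective_def power2_norm_eq_inner)
  have der: "(objective T b has_derivative D) (at z)"
    unfolding obj D_def
    by (rule derivative_eq_intros FDERIV refl)+ (auto simp: inner_commute algebra_simps)
  then have lin: "linear D" by (rule has_derivative_linear)
  have repr: "D h = inner h (adjoint D 1)" for h
    using adjoint_works[OF lin, of h 1] by simp
  have "gradient (objective T b) z = adjoint D 1"
    unfolding gradient_def
  proof (rule the_equality)
    show "GDERIV (objective T b) z :> adjoint D 1"
      using der unfolding gderiv_def repr[symmetric] by simp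
  next
    fix d assume "GDERIV (objective T b) z :> d"
    then have "(\<lambda>h. inner h d) = D"
      unfolding gderiv_def by (rule has_derivative_unique) (rule der)
    then have "inner h d = inner h (adjoint D 1)" for h
      using repr[of h] by metis
    then show "d = adjoint D 1"
      by (metis inner_commute vector_eq_rdot)
  qed
  then show ?thesis using repr[of h] by (simp add: D_def inner_commute)
qed

text \<open>With one block fixed the objective is a least-squares function of the other one, so its
  second-order expansion is exact.\<close>

lemma objective_expand_fst:
  "objective T b (x + d, y) = objective T b (x, y)
     + inner (fst (gradient (objective T b) (x, y))) d + 1 / 2 * (norm (tensor_apply T d y))\<^sup>2"
proof -
  interpret bounded_bilinear "tensor_apply T" by (rule bounded_bilinear_tensor_apply)
  have "inner (fst (gradient (objective T b) (x, y))) d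
      = inner (tensor_apply T x y - b) (tensor_apply T d y)"
    using inner_gradient_objective[of T b "(x, y)" "(d, 0)"]
    by (simp add: inner_prod_def zero_right)
  moreover have "tensor_apply T (x + d) y - b = (tensor_apply T x y - b) + tensor_apply T d y"
    by (simp add: add_left)
  ultimately show ?thesis
    by (simp add: objective_def power2_norm_eq_inner inner_add_left inner_add_right
        inner_commute algebra_simps)
qed

lemma objective_expand_snd:
  "objective T b (x, y + d) = objective T b (x, y)
     + inner (snd (gradient (objective T b) (x, y))) d + 1 / 2 * (norm (tensor_apply T x d))\<^sup>2"
proof -
  interpret bounded_bilinear "tensor_apply T" by (rule bounded_bilinear_tensor_apply)
  have "inner (snd (gradient (objective T b) (x, y))) d
      = inner (tensor_apply T x y - b) (tensor_apply T x d)"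
    using inner_gradient_objective[of T b "(x, y)" "(0, d)"]
    by (simp add: inner_prod_def zero_left)
  moreover have "tensor_apply T x (y + d) - b = (tensor_apply T x y - b) + tensor_apply T x d"
    by (simp add: add_right)
  ultimately show ?thesis
    by (simp add: objective_def power2_norm_eq_inner inner_add_left inner_add_right
        inner_commute algebra_simps)
qed

section \<open>Sparse vectors\<close>

lemma supp_eq_empty_iff: "supp v = {} \<longleftrightarrow> v = 0"
  by (auto simp: supp_def vec_eq_iff)

lemma supp_scaleR: "c \<noteq> 0 \<Longrightarrow> supp (c *\<^sub>R v) = supp v"
  by (auto simp: supp_def)

lemma norm0_scaleR: "c \<noteq> 0 \<Longrightarrow> norm0 (c *\<^sub>R v) = norm0 v"
  by (simp add: norm0_def supp_scaleR)

lemma first_nonzero_in_supp: "v \<noteq> 0 \<Longrightarrow> first_nonzero v \<in> supp v"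
  unfolding first_nonzero_def by (intro Min_in) (auto simp: supp_eq_empty_iff)

lemma power2_norm_vec: "(norm (v :: real^'k))\<^sup>2 = (\<Sum>i\<in>UNIV. (v $ i)\<^sup>2)"
  unfolding power2_norm_eq_inner by (simp add: inner_vec_def power2_eq_square)

text \<open>Compared with \<open>y\<close>, leaving out an index of \<open>supp y\<close> costs at least \<open>M\<^sup>2\<close>, and each
  index that \<open>v\<close> uses instead gains less than \<open>M\<^sup>2\<close>. The cardinality bound says that at least as
  many indices are left out as are added.\<close>

lemma hard_threshold_unique:
  fixes y q v :: "real^'k"
  assumes M: "0 < M"
    and eq: "\<And>i. i \<in> supp y \<Longrightarrow> q $ i = y $ i"
    and large: "\<And>i. i \<in> supp y \<Longrightarrow> M \<le> \<bar>y $ i\<bar>"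
    and small: "\<And>i. i \<notin> supp y \<Longrightarrow> \<bar>q $ i\<bar> < M"
    and card: "card (supp v) \<le> card (supp y)"
    and "v \<noteq> y"
  shows "(norm (y - q))\<^sup>2 < (norm (v - q))\<^sup>2"
proof -
  let ?S = "supp y" and ?V = "supp v"
  \<comment> \<open>\<open>\<delta> i\<close> is a lower bound for the change of the squared error in coordinate \<open>i\<close> when \<open>y\<close> is
    replaced by \<open>v\<close>.\<close>
  define \<delta> where "\<delta> i = (if i \<in> ?S - ?V then M\<^sup>2 else 0) - (if i \<in> ?V - ?S then M\<^sup>2 else 0)" for i
  have "(\<Sum>i\<in>UNIV. if i \<in> A then M\<^sup>2 else 0) = real (card A) * M\<^sup>2" for A :: "'k set"
    by (simp add: sum.If_cases)
  then have sum: "(\<Sum>i\<in>UNIV. \<delta> i) = (real (card (?S - ?V)) - real (card (?V - ?S))) * M\<^sup>2"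
    unfolding \<delta>_def sum_subtractf by (simp only: left_diff_distrib)
  have diff: "card (?V - ?S) \<le> card (?S - ?V)"
    by (rule card_le_sym_Diff) (use card in auto)
  have ge0: "0 \<le> (\<Sum>i\<in>UNIV. \<delta> i)"
    unfolding sum using diff by (intro mult_nonneg_nonneg) auto
  have sq: "(q $ i)\<^sup>2 < M\<^sup>2" if "i \<notin> ?S" for i
    using power_strict_mono[OF small[OF that], of 2] by simp
  have ptw: "\<delta> i \<le> (v $ i - q $ i)\<^sup>2 - (y $ i - q $ i)\<^sup>2" for i
  proof (cases "i \<in> ?S")
    case True
    then have "i \<notin> ?V \<Longrightarrow> M\<^sup>2 \<le> (y $ i)\<^sup>2"
      using power_mono[OF large[OF True], of 2] M by simp
    then show ?thesis using True eq[OF True] by (auto simp: \<delta>_def supp_def)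
  next
    case False
    then have y0: "y $ i = 0" by (simp add: supp_def)
    show ?thesis
    proof (cases "i \<in> ?V")
      case True
      then have "\<delta> i = - M\<^sup>2" using False by (simp add: \<delta>_def)
      moreover have "0 \<le> (v $ i - q $ i)\<^sup>2" by simp
      moreover have "(y $ i - q $ i)\<^sup>2 = (q $ i)\<^sup>2" by (simp add: y0)
      ultimately show ?thesis using sq[OF False] by linarith
    next
      case notin: False
      then have "\<delta> i = 0" "v $ i = 0" using False by (simp_all add: \<delta>_def supp_def)
      then show ?thesis using y0 by simp
    qed
  qed
  have "0 < (\<Sum>i\<in>UNIV. (v $ i - q $ i)\<^sup>2 - (y $ i - q $ i)\<^sup>2)"
  proof (cases "?V \<subset> ?S")
    case True
    then have "?V - ?S \<subset> ?S - ?V" by auto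
    then have "card (?V - ?S) < card (?S - ?V)" by (intro psubset_card_mono) auto
    then have "0 < (\<Sum>i\<in>UNIV. \<delta> i)" unfolding sum using M by (intro mult_pos_pos) auto
    also have "\<dots> \<le> (\<Sum>i\<in>UNIV. (v $ i - q $ i)\<^sup>2 - (y $ i - q $ i)\<^sup>2)"
      by (intro sum_mono ptw)
    finally show ?thesis .
  next
    case False
    have "\<exists>i. \<delta> i < (v $ i - q $ i)\<^sup>2 - (y $ i - q $ i)\<^sup>2"
    proof (cases "?V \<subseteq> ?S")
      case True
      with False have VS: "?V = ?S" by auto
      obtain i where i: "v $ i \<noteq> y $ i" using \<open>v \<noteq> y\<close> by (auto simp: vec_eq_iff)
      then have "i \<in> ?V \<or> i \<in> ?S" by (auto simp: supp_def)
      then have "i \<in> ?S" by (simp add: VS)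
      then have "\<delta> i = 0" "0 < (v $ i - q $ i)\<^sup>2" "(y $ i - q $ i)\<^sup>2 = 0"
        using i eq[of i] VS by (simp_all add: \<delta>_def)
      then have "\<delta> i < (v $ i - q $ i)\<^sup>2 - (y $ i - q $ i)\<^sup>2" by linarith
      then show ?thesis by blast
    next
      case False
      then obtain i where i: "i \<in> ?V" "i \<notin> ?S" by auto
      then have "\<delta> i = - M\<^sup>2" "(y $ i - q $ i)\<^sup>2 = (q $ i)\<^sup>2"
        by (auto simp: \<delta>_def supp_def)
      moreover have "0 \<le> (v $ i - q $ i)\<^sup>2" by simp
      ultimately have "\<delta> i < (v $ i - q $ i)\<^sup>2 - (y $ i - q $ i)\<^sup>2"
        using sq[OF i(2)] by linarith
      then show ?thesis by blast
    qed
    then have "(\<Sum>i\<in>UNIV. \<delta> i) < (\<Sum>i\<in>UNIV. (v $ i - q $ i)\<^sup>2 - (y $ i - q $ i)\<^sup>2)"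
      using ptw by (intro sum_strict_mono_ex1) auto
    with ge0 show ?thesis by linarith
  qed
  then show ?thesis by (simp add: power2_norm_vec sum_subtractf)
qed

section \<open>Consequences of optimality\<close>

text \<open>Rescaling turns any nonzero \<open>s\<close>-sparse \<open>v\<close> into a member of \<open>F1 s\<close>, and the inverse factor is
  absorbed by \<open>y\<close>; the objective depends on the product only. Hence optimality in \<open>x\<close> over the
  normalized set extends to all nonzero sparse vectors.\<close>

lemma optimal_fst_unnormalized:
  fixes T :: "real^'n^'m::{finite,linorder}^'l"
  assumes opt: "is_arg_min (objective T b) (\<lambda>z. z \<in> feasible s t) (x, y)"
    and v: "v \<noteq> 0" "norm0 v \<le> s"
  shows "objective T b (x, y) \<le> objective T b (v, y)"
proof -
  interpret bounded_bilinear "tensor_apply T" by (rule bounded_bilinear_tensor_apply)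
  define c where "c = v $ first_nonzero v"
  have c: "c \<noteq> 0" using first_nonzero_in_supp[OF v(1)] by (simp add: c_def supp_def)
  have "first_nonzero (v /\<^sub>R c) = first_nonzero v"
    using c by (simp add: first_nonzero_def supp_scaleR)
  then have "v /\<^sub>R c \<in> F1 s"
    using c v by (simp add: F1_def norm0_scaleR c_def[symmetric])
  moreover have "c *\<^sub>R y \<in> F2 t"
    using opt c by (simp add: is_arg_min_def feasible_def F2_def norm0_scaleR)
  ultimately have "objective T b (x, y) \<le> objective T b (v /\<^sub>R c, c *\<^sub>R y)"
    using opt by (simp add: is_arg_min_linorder feasible_def)
  also have "\<dots> = objective T b (v, y)"
    using c by (simp add: objective_def scaleR_left scaleR_right)
  finally show ?thesis .
qed

text \<open>Multiplying out, \<open>\<parallel>v - p\<parallel>\<^sup>2 - \<parallel>x - p\<parallel>\<^sup>2\<close> is \<open>2 / L\<close> times the upper quadratic model of the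
  objective increment with curvature \<open>L\<close>. The model strictly exceeds the true increment, which is
  nonnegative by optimality.\<close>

lemma gradient_step_fst_unique:
  fixes T :: "real^'n^'m::{finite,linorder}^'l" and x v :: "real^'m::{finite,linorder}"
  assumes opt: "is_arg_min (objective T b) (\<lambda>z. z \<in> feasible s t) (x, y)"
    and L: "L > lambda_max (transpose (contract3 T y) ** contract3 T y)"
    and v: "v \<noteq> 0" "norm0 v \<le> s" "v \<noteq> x"
  defines "p \<equiv> x - fst (gradient (objective T b) (x, y)) /\<^sub>R L"
  shows "(norm (x - p))\<^sup>2 < (norm (v - p))\<^sup>2"
proof -
  let ?A = "contract3 T y" and ?g = "fst (gradient (objective T b) (x, y))"
  define d where "d = v - x"
  have L0: "0 < L" using lambda_max_gram_nonneg[of ?A] L by linarith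
  have "0 \<le> inner ?g d + 1 / 2 * (norm (?A *v d))\<^sup>2"
    using optimal_fst_unnormalized[OF opt v(1,2)] objective_expand_fst[of T b x d y]
    by (simp add: d_def tensor_apply_eq_contract3)
  moreover have "(norm (?A *v d))\<^sup>2 < L * (norm d)\<^sup>2"
  proof -
    have "(norm (?A *v d))\<^sup>2 \<le> lambda_max (transpose ?A ** ?A) * (norm d)\<^sup>2"
      by (rule norm_matrix_vector_le_lambda_max)
    also have "\<dots> < L * (norm d)\<^sup>2" using L v(3) by (simp add: d_def)
    finally show ?thesis .
  qed
  ultimately have "0 < 2 * inner ?g d + L * (norm d)\<^sup>2" by linarith
  then have "0 < (2 * inner ?g d + L * (norm d)\<^sup>2) / L" using L0 by simp
  also have "\<dots> = (norm (v - p))\<^sup>2 - (norm (x - p))\<^sup>2"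
  proof -
    have eqs: "v - p = d + ?g /\<^sub>R L" "x - p = ?g /\<^sub>R L" by (simp_all add: p_def d_def)
    show ?thesis
      unfolding eqs power2_norm_eq_inner using L0
      by (simp add: inner_add_left inner_add_right inner_commute field_simps)
  qed
  finally show ?thesis by simp
qed

text \<open>The coordinates in question are those that can be varied freely without leaving the set of
  \<open>t\<close>-sparse vectors.\<close>

lemma gradient_snd_zero:
  fixes T :: "real^'n^'m::{finite,linorder}^'l"
  assumes opt: "is_arg_min (objective T b) (\<lambda>z. z \<in> feasible s t) (x, y)"
    and i: "i \<in> supp y \<or> norm0 y < t"
  shows "snd (gradient (objective T b) (x, y)) $ i = 0"
proof -
  interpret bounded_bilinear "tensor_apply T" by (rule bounded_bilinear_tensor_apply)
  have feas: "x \<in> F1 s" "norm0 y \<le> t"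
    using opt by (auto simp: is_arg_min_def feasible_def F2_def)
  let ?e = "axis i (1::real)"
  show ?thesis
  proof (rule quadratic_nonneg_imp_linear_coeff_zero)
    fix \<tau> :: real
    have "supp (y + \<tau> *\<^sub>R ?e) \<subseteq> insert i (supp y)" by (auto simp: supp_def axis_def)
    then have "norm0 (y + \<tau> *\<^sub>R ?e) \<le> card (insert i (supp y))"
      unfolding norm0_def by (intro card_mono) auto
    also have "\<dots> \<le> t" using i feas(2) by (auto simp: norm0_def card_insert_if)
    finally have "objective T b (x, y) \<le> objective T b (x, y + \<tau> *\<^sub>R ?e)"
      using opt feas by (simp add: is_arg_min_linorder feasible_def F2_def)
    then show "0 \<le> \<tau> * snd (gradient (objective T b) (x, y)) $ i
        + \<tau>\<^sup>2 * (1 / 2 * (norm (tensor_apply T x ?e))\<^sup>2)"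
      using objective_expand_snd[of T b x y "\<tau> *\<^sub>R ?e"]
      by (simp add: scaleR_right inner_axis power_mult_distrib)
  qed
qed

text \<open>If \<open>y\<close> has fewer than \<open>t\<close> nonzero entries, the \<open>t\<close>-th largest absolute value is 0, but
  then the whole partial gradient vanishes and \<open>q = y\<close>. Otherwise \<open>q\<close> agrees with \<open>y\<close> on its
  support, and the bound on \<open>L\<close> makes it smaller elsewhere than every nonzero entry of \<open>y\<close>.\<close>

lemma gradient_step_snd_unique:
  fixes T :: "real^'n^'m::{finite,linorder}^'l" and y v :: "real^'n"
  assumes opt: "is_arg_min (objective T b) (\<lambda>z. z \<in> feasible s t) (x, y)"
    and t: "1 \<le> t" and L0: "0 < L"
    and L: "\<And>i. i \<notin> supp y \<Longrightarrow>
      \<bar>snd (gradient (objective T b) (x, y)) $ i\<bar> / kth_largest t (abs_vec y) < L"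
    and v: "norm0 v \<le> t" "v \<noteq> y"
  defines "q \<equiv> y - snd (gradient (objective T b) (x, y)) /\<^sub>R L"
  shows "(norm (y - q))\<^sup>2 < (norm (v - q))\<^sup>2"
proof (cases "norm0 y < t")
  case True
  then have "q = y"
    using gradient_snd_zero[OF opt] by (simp add: q_def vec_eq_iff)
  then show ?thesis using v(2) by simp
next
  case False
  then have card: "card (supp y) = t"
    using opt by (auto simp: is_arg_min_def feasible_def F2_def norm0_def)
  let ?M = "kth_largest t (abs_vec y)"
  have M: "0 < ?M" by (rule kth_largest_abs_vec_pos[OF t card])
  show ?thesis
  proof (rule hard_threshold_unique[OF M])
    fix i assume i: "i \<in> supp y"
    then show "q $ i = y $ i" using gradient_snd_zero[OF opt, of i] by (simp add: q_def)
    show "?M \<le> \<bar>y $ i\<bar>" by (rule kth_largest_abs_vec_le[OF t card i])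
  next
    fix i assume i: "i \<notin> supp y"
    then show "\<bar>q $ i\<bar> < ?M"
      using L[OF i] L0 M by (simp add: q_def supp_def abs_mult field_simps)
  qed (use v card in \<open>auto simp: norm0_def\<close>)
qed

section \<open>The like-projection of the gradient step\<close>

lemma psi_eq_scaled:
  assumes "fst z \<noteq> 0" "common_supp z u \<noteq> {}"
  obtains c where "c \<noteq> 0" "psi z u = (c *\<^sub>R fst u, snd u /\<^sub>R c)"
proof
  have "Min (common_supp z u) \<in> common_supp z u" using assms(2) by (intro Min_in) auto
  then show "fst z $ Min (common_supp z u) \<noteq> 0" by (simp add: common_supp_def)
  show "psi z u = (fst z $ Min (common_supp z u) *\<^sub>R fst u,
      snd u /\<^sub>R (fst z $ Min (common_supp z u)))"
    using assms(1) unfolding psi_def Let_def if_not_P[OF assms(1)]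
    by (simp add: vec_eq_iff divide_inverse mult.commute)
qed

theorem theorem3p15:
  fixes T :: "real^'n^'m::{finite,linorder}^'l"
    and b :: "real^'l"
    and s t :: nat
    and L :: real
    and x :: "real^'m::{finite,linorder}" and y :: "real^'n"
  assumes s: "1 \<le> s" "s < CARD('m)"
    and t: "1 \<le> t" "t < CARD('n)"
    and opt: "is_arg_min (objective T b) (\<lambda>z. z \<in> feasible s t) (x, y)"
    and grad: "fst (gradient (objective T b) (x, y)) $ first_nonzero x = 0"
    and L: "L > max (lambda_max (transpose (contract3 T y) ** contract3 T y))
                    (MAX i\<in>UNIV - supp y.
                       \<bar>snd (gradient (objective T b) (x, y)) $ i\<bar> / kth_largest t (abs_vec y))"
  shows "like_stationary T b s t L (x, y) \<and>
         is_singleton (like_projection s t ((x, y) - gradient (objective T b) (x, y) /\<^sub>R L)) \<and>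
         like_projection s t ((x, y) - gradient (objective T b) (x, y) /\<^sub>R L) = {(x, y)}"
proof -
  define g where "g = gradient (objective T b) (x, y)"
  define w where "w = (x, y) - g /\<^sub>R L"
  define p where "p = x - fst g /\<^sub>R L"
  define q where "q = y - snd g /\<^sub>R L"
  have w: "w = (p, q)" by (simp add: w_def p_def q_def prod_eq_iff)
  have feas: "x \<in> F1 s" "y \<in> F2 t" using opt by (auto simp: is_arg_min_def feasible_def)
  have Lx: "L > lambda_max (transpose (contract3 T y) ** contract3 T y)" using L by simp
  have L0: "0 < L" using lambda_max_gram_nonneg[of "contract3 T y"] Lx by linarith
  have Ly: "\<bar>snd g $ i\<bar> / kth_largest t (abs_vec y) < L" if "i \<notin> supp y" for i
  proof -
    have "\<bar>snd g $ i\<bar> / kth_largest t (abs_vec y)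
        \<le> (MAX i\<in>UNIV - supp y. \<bar>snd g $ i\<bar> / kth_largest t (abs_vec y))"
      using that by (intro Max_ge) auto
    also have "\<dots> < L" using L by (simp add: g_def)
    finally show ?thesis .
  qed
  have xmin: "(norm (x - p))\<^sup>2 < (norm (v - p))\<^sup>2" if "v \<noteq> 0" "norm0 v \<le> s" "v \<noteq> x" for v
    using gradient_step_fst_unique[OF opt Lx that] by (simp add: p_def g_def)
  have ymin: "(norm (y - q))\<^sup>2 < (norm (v - q))\<^sup>2" if "norm0 v \<le> t" "v \<noteq> y" for v
    using gradient_step_snd_unique[OF opt t(1) L0 _ that] Ly by (simp add: q_def g_def)

  have x0: "x \<noteq> 0" and x1: "x $ first_nonzero x = 1" using feas(1) by (auto simp: F1_def)
  have p1: "p $ first_nonzero x = 1" using x1 grad by (simp add: p_def g_def)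
  then have p0: "p \<noteq> 0" by auto
  \<comment> \<open>As the gradient vanishes at the pivot index of \<open>x\<close>, that index is also the pivot used by
    \<open>psi w\<close>, with scaling factor 1.\<close>
  have pivot: "first_nonzero x \<in> common_supp w (x, y)"
    using x1 p1 by (simp add: common_supp_def w)
  have "Min (common_supp w (x, y)) = first_nonzero x"
  proof (rule Min_eqI[OF _ _ pivot])
    fix i assume "i \<in> common_supp w (x, y)"
    then have "i \<in> supp x" by (simp add: common_supp_def supp_def)
    then show "first_nonzero x \<le> i" by (simp add: first_nonzero_def)
  qed simp
  then have psi_xy: "psi w (x, y) = (x, y)"
    using p0 p1 by (simp add: psi_def w vec_eq_iff)
  have def_xy: "psi_defined w (x, y)" using pivot by (auto simp: psi_defined_def)

  have strict: "(norm (psi w (x, y) - w))\<^sup>2 < (norm (psi w u - w))\<^sup>2"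
    if u: "u \<in> feasible s t" "psi_defined w u" "u \<noteq> (x, y)" for u
  proof -
    obtain u1 u2 where u12: "u = (u1, u2)" by (cases u)
    have u1: "u1 \<noteq> 0" "norm0 u1 \<le> s" "u1 $ first_nonzero u1 = 1" and u2: "norm0 u2 \<le> t"
      using u(1) by (auto simp: u12 feasible_def F1_def F2_def)
    obtain c where c: "c \<noteq> 0" and psi_u: "psi w u = (c *\<^sub>R u1, u2 /\<^sub>R c)"
      using psi_eq_scaled[of w u] u(2) p0 by (auto simp: psi_defined_def w u12)
    have s1: "c *\<^sub>R u1 \<noteq> 0" "norm0 (c *\<^sub>R u1) \<le> s" "norm0 (u2 /\<^sub>R c) \<le> t"
      using c u1 u2 by (simp_all add: norm0_scaleR)
    have "c *\<^sub>R u1 \<noteq> x \<or> u2 /\<^sub>R c \<noteq> y"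
    proof (rule ccontr)
      assume "\<not> ?thesis"
      then have eqs: "c *\<^sub>R u1 = x" "u2 /\<^sub>R c = y" by auto
      \<comment> \<open>Both first blocks are normalized, so the scaling factor must be 1.\<close>
      then have "first_nonzero x = first_nonzero u1"
        using c by (auto simp: first_nonzero_def supp_scaleR)
      then have "c = 1" using x1 u1(3) by (simp add: eqs(1)[symmetric])
      then show False using eqs u(3) by (simp add: u12)
    qed
    then have "(norm (x - p))\<^sup>2 + (norm (y - q))\<^sup>2
        < (norm (c *\<^sub>R u1 - p))\<^sup>2 + (norm (u2 /\<^sub>R c - q))\<^sup>2"
      using xmin[OF s1(1,2)] ymin[OF s1(3)] by (smt (verit))
    then show ?thesis unfolding psi_xy psi_u by (simp add: w norm_Pair)
  qed
  have feas_xy: "(x, y) \<in> feasible s t" using feas by (simp add: feasible_def)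
  have proj: "like_projection s t w = {(x, y)}"
  proof (intro equalityI subsetI)
    fix u assume "u \<in> like_projection s t w"
    then show "u \<in> {(x, y)}"
      using strict[of u] feas_xy def_xy by (auto simp: like_projection_def is_arg_min_def)
  next
    fix u assume "u \<in> {(x, y)}"
    moreover have "\<not> (norm (psi w u - w))\<^sup>2 < (norm (psi w (x, y) - w))\<^sup>2"
      if "u \<in> feasible s t" "psi_defined w u" for u
      using strict[OF that] by (cases "u = (x, y)") auto
    ultimately show "u \<in> like_projection s t w"
      using feas_xy def_xy unfolding like_projection_def is_arg_min_def by blast
  qed
  show ?thesis
    using proj L0 feas_xy grad unfolding like_stationary_def w_def g_def is_singleton_def by auto
qed

end
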